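(* Let $q$ be a prime power. Any maximum scattered $\mathbb{F}_q$-linear set in $\mathrm{PG}(1,q^4)$ is projectively equivalent to $L_{U(b)}$ for some $b\in\mathbb{F}_{q^4}$ with $\mathrm{N}_{q^4/q}(b)\neq 1$, where $U(b)=\{(x,bx^q+x^{q^3}) : x\in\mathbb{F}_{q^4}\}$.
   Context: Points of $\mathrm{PG}(1,q^4)$ are the one-dimensional $\mathbb{F}_{q^4}$-subspaces $\langle \mathbf v\rangle_{\mathbb{F}_{q^4}}$, $\mathbf v\neq\mathbf 0$, of $\mathbb{F}_{q^4}^2$. For an $\mathbb{F}_q$-subspace $U$ of $\mathbb{F}_{q^4}^2$, the associated $\mathbb{F}_q$-linear set is $L_U=\{\langle \mathbf v\rangle_{\mathbb{F}_{q^4}} : \mathbf v\in U\setminus\{\mathbf 0\}\}$; its rank is $\dim_{\mathbb{F}_q}U$. $L_U$ is scattered if $\dim_{\mathbb{F}_q}(U\cap P)=1$ for every point $P\in L_U$; it is maximum scattered if it is scattered and has rank $4$. Two point sets of $\mathrm{PG}(1,q^4)$ are projectively equivalent if an element of $\mathrm{PGL}(2,q^4)$ maps one onto the other. $\mathrm{N}_{q^4/q}(b)=b^{1+q+q^2+q^3}$. *)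

theory Defs
  imports "HOL-Analysis.Cartesian_Space" "HOL-Number_Theory.Prime_Powers"
begin

text \<open>
  The fields with \<open>q\<close> and \<open>q\<^sup>4\<close> elements are finite field types \<open>'k\<close> and \<open>'a\<close>, and the
  inclusion of the former in the latter is a unital ring homomorphism \<open>\<iota> :: 'k \<Rightarrow> 'a\<close>. Its image is
  necessarily the unique subfield with \<open>q\<close> elements. Having the small field as a type makes
  \<^locale>\<open>vector_space\<close> applicable.
\<close>

definition field_embedding :: "('k::field \<Rightarrow> 'a::field) \<Rightarrow> bool" where
  "field_embedding \<iota> \<longleftrightarrow>
     \<iota> 1 = 1 \<and> (\<forall>x y. \<iota> (x + y) = \<iota> x + \<iota> y) \<and> (\<forall>x y. \<iota> (x * y) = \<iota> x * \<iota> y)"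

definition restr_scale :: "('k::field \<Rightarrow> 'a::field) \<Rightarrow> 'k \<Rightarrow> 'a ^ 2 \<Rightarrow> 'a ^ 2" where
  "restr_scale \<iota> c v = \<iota> c *s v"

lemma vector_space_restr_scale:
  assumes "field_embedding \<iota>"
  shows "vector_space (restr_scale \<iota>)"
  using assms
  by unfold_locales
    (auto simp: restr_scale_def field_embedding_def vec_eq_iff algebra_simps)

abbreviation Fq_subspace :: "('k::field \<Rightarrow> 'a::field) \<Rightarrow> ('a ^ 2) set \<Rightarrow> bool" where
  "Fq_subspace \<iota> \<equiv> module.subspace (restr_scale \<iota>)"

abbreviation Fq_dim :: "('k::field \<Rightarrow> 'a::field) \<Rightarrow> ('a ^ 2) set \<Rightarrow> nat" where
  "Fq_dim \<iota> \<equiv> vector_space.dim (restr_scale \<iota>)"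

text \<open>A point is the set of vectors of a one-dimensional subspace over the large field, so it
  contains the zero vector.\<close>

definition linear_set :: "('a::field ^ 2) set \<Rightarrow> ('a ^ 2) set set" where
  "linear_set U = {vec.span {v} | v. v \<in> U - {0}}"

definition scattered :: "('k::field \<Rightarrow> 'a::field) \<Rightarrow> ('a ^ 2) set \<Rightarrow> bool" where
  "scattered \<iota> U \<longleftrightarrow> (\<forall>P \<in> linear_set U. Fq_dim \<iota> (U \<inter> P) = 1)"

text \<open>Rank and scatteredness refer to a subspace defining the linear set. A point set counts as
  maximum scattered if some defining subspace witnesses both.\<close>

definition maximum_scattered_linear_set ::
    "('k::field \<Rightarrow> 'a::field) \<Rightarrow> ('a ^ 2) set set \<Rightarrow> bool" where
  "maximum_scattered_linear_set \<iota> L \<longleftrightarrow>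
     (\<exists>U. Fq_subspace \<iota> U \<and> L = linear_set U \<and> scattered \<iota> U \<and> Fq_dim \<iota> U = 4)"

text \<open>An element of the projective linear group is the class of an invertible matrix \<open>A\<close> modulo
  nonzero scalars. It maps a point \<open>P\<close> to the image of \<open>P\<close> under \<open>A\<close>.\<close>

definition projectively_equivalent :: "('a::field ^ 2) set set \<Rightarrow> ('a ^ 2) set set \<Rightarrow> bool" where
  "projectively_equivalent L L' \<longleftrightarrow>
     (\<exists>A :: 'a ^ 2 ^ 2. invertible A \<and> (\<lambda>P. (\<lambda>v. A *v v) ` P) ` L = L')"

definition field_norm4 :: "nat \<Rightarrow> 'a::field \<Rightarrow> 'a" where
  "field_norm4 q b = b ^ (1 + q + q ^ 2 + q ^ 3)"

definition U_sub :: "nat \<Rightarrow> 'a::field \<Rightarrow> ('a ^ 2) set" where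
  "U_sub q b = {vector [x, b * x ^ q + x ^ (q ^ 3)] | x. True}"

end

theory Submission
  imports
    "HOL-Algebra.Algebraic_Closure_Type"
    "HOL-Number_Theory.Residues"
    "HOL-Analysis.Determinants"
    Defs
begin

text \<open>
  Write \<open>\<phi> x = x ^ q\<close>. Fewer than \<open>q ^ 4 + 1\<close> points carry nonzero vectors of a subspace \<open>U\<close> of rank four, so
  some point is missed; moving it to \<open>x = 0\<close> makes \<open>U\<close> the graph of a map that is linear over the small
  field. By counting, such a map is a linearized polynomial
  \<open>f x = a\<^sub>0 x + a\<^sub>1 \<phi> x + a\<^sub>2 \<phi>\<^sup>2 x + a\<^sub>3 \<phi>\<^sup>3 x\<close> (\<open>equivalent_to_graph\<close>). Shears and scalings
  reach the form \<open>b \<phi> x + \<phi>\<^sup>3 x\<close> as soon as \<open>a\<^sub>2 = 0\<close>, so everything depends on making \<open>a\<^sub>2\<close> vanish.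

  The available freedom is the choice of the point that is moved to \<open>x = 0\<close>. Moving the point \<open>(1, k)\<close>
  there replaces \<open>f\<close> by the inverse of \<open>f - k\<close>, the map \<open>x \<mapsto> f x - k x\<close>. Its coefficient at
  \<open>\<phi>\<^sup>2 x\<close> is a cofactor of the matrix that represents \<open>f - k\<close>, and the vanishing of this cofactor is an
  equation of the form \<open>(m + s) * (m' + t) = K\<close>, where \<open>m = \<phi> k\<close> and \<open>m'\<close> is its conjugate over the
  field with \<open>q\<^sup>2\<close> elements. A sesquilinear equation of this kind can fail to have solutions, but here it
  reduces to a quadratic equation whose coefficients, being made of norms and traces, lie in the field
  with \<open>q\<close> elements, and such an equation is solvable in the field with \<open>q\<^sup>2\<close> elements
  (\<open>sesquilinear_solvable\<close>). For the solution \<open>k\<close> the map \<open>f - k\<close> is indeed invertible: if it were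
  singular, scatteredness would force its adjugate to have rank one, and a linearized polynomial of rank
  one has no zero coefficient (\<open>quasi_inverse_nondegenerate\<close>).

  It remains to see that \<open>N(b) = 1\<close> contradicts scatteredness. Then \<open>b = \<phi> c / c\<close> by Hilbert 90, so that
  \<open>c (b \<phi> x + \<phi>\<^sup>3 x) = \<phi> (c x) + c \<phi>\<^sup>3 x\<close> is self-adjoint for the trace form, and the search for two
  independent vectors on one point turns into the search for an isotropic vector of a binary Hermitian
  form (\<open>proportional_vectors_if_norm_one\<close>, \<open>hermitian_isotropic\<close>).
\<close>

section \<open>Counting in finite fields and vector spaces\<close>

lemma card_range_times_card_kernel:
  fixes h :: "'b::{ab_group_add,finite} \<Rightarrow> 'c::ab_group_add"
  assumes add: "\<And>x y. h (x + y) = h x + h y"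
  shows "card (range h) * card {x. h x = 0} = CARD('b)"
proof -
  have diff: "h (x - y) = h x - h y" for x y
    using add[of "x - y" y] by simp
  have "card (h -` {z}) = card {x. h x = 0}" if "z \<in> range h" for z
  proof -
    obtain y where z: "z = h y" using \<open>z \<in> range h\<close> by auto
    have "h -` {z} = (\<lambda>x. x + y) ` {x. h x = 0}"
    proof (intro subset_antisym subsetI)
      fix x assume "x \<in> h -` {z}"
      thus "x \<in> (\<lambda>x. x + y) ` {x. h x = 0}"
        by (intro image_eqI[of _ _ "x - y"]) (auto simp: z diff)
    qed (auto simp: z add)
    thus ?thesis by (simp add: card_image inj_on_def)
  qed
  hence "(\<Sum>z\<in>range h. card (h -` {z})) = card (range h) * card {x. h x = 0}"
    by simp
  moreover have "(\<Sum>z\<in>range h. card (h -` {z})) = card (\<Union>z\<in>range h. h -` {z})"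
    by (rule card_UN_disjoint[symmetric]) auto
  moreover have "(\<Union>z\<in>range h. h -` {z}) = UNIV" by auto
  ultimately show ?thesis by simp
qed

lemma finite_field_power_card_minus_one:
  fixes x :: "'b::{field,finite}"
  assumes "x \<noteq> 0"
  shows "x ^ (CARD('b) - 1) = 1"
proof -
  have "bij_betw ((*) x) (UNIV - {0}) (UNIV - {0})"
    by (rule bij_betwI[where g = "\<lambda>y. y / x"]) (use assms in auto)
  hence "(\<Prod>y\<in>UNIV - {0}. x * y) = (\<Prod>y\<in>UNIV - {0}. y)"
    by (rule prod.reindex_bij_betw)
  hence "x ^ card (UNIV - {0 :: 'b}) * \<Prod>(UNIV - {0 :: 'b}) = \<Prod>(UNIV - {0})"
    by (simp add: prod.distrib)
  moreover have "\<Prod>(UNIV - {0 :: 'b}) \<noteq> 0" by (subst prod_zero_iff) auto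
  ultimately show ?thesis by (simp add: card_Diff_singleton)
qed

text \<open>
  Every fibre of \<open>x \<mapsto> x ^ m\<close> on nonzero elements has at most \<open>m\<close> points, so the image has at least
  \<open>n\<close> elements; it lies among the at most \<open>n\<close> roots of \<open>y ^ n = 1\<close> and therefore exhausts them. Both the
  multiplicative form of Hilbert 90 and the surjectivity of norms between finite fields are
  instances of this, for suitable factorizations \<open>m * n\<close> of the order of the unit group.
\<close>

lemma finite_field_ex_root:
  fixes y :: "'b::{field,finite}"
  assumes mn: "m * n = CARD('b) - 1" and y: "y ^ n = 1"
  shows "\<exists>x. x \<noteq> 0 \<and> x ^ m = y"
proof -
  let ?P = "\<lambda>x::'b. x ^ m"
  have "CARD('b) \<ge> card {0, 1 :: 'b}" by (rule card_mono) auto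
  hence "m * n > 0" using mn by simp
  hence pos: "m > 0" "n > 0" by auto
  have roots: "card {x::'b. x ^ k = c} \<le> k" if "k > 0" for k c
  proof -
    let ?p = "monom 1 k - [:c:] :: 'b poly"
    have deg: "degree ?p = k" using that
      by (subst diff_conv_add_uminus, subst degree_add_eq_left) (auto simp: degree_monom_eq)
    hence "?p \<noteq> 0" using that by auto
    from card_poly_roots_bound[OF this] show ?thesis by (simp add: deg poly_monom)
  qed
  have "m * n = card (UNIV - {0 :: 'b})" by (simp add: mn card_Diff_singleton)
  also have "\<dots> = card (\<Union>z\<in>?P ` (UNIV - {0}). {x. x ^ m = z} - {0})"
    by (rule arg_cong[of _ _ card]) auto
  also have "\<dots> \<le> (\<Sum>z\<in>?P ` (UNIV - {0}). card ({x. x ^ m = z} - {0}))"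
    by (rule card_UN_le) simp
  also have "\<dots> \<le> (\<Sum>z\<in>?P ` (UNIV - {0}). m)"
    by (intro sum_mono order_trans[OF card_mono roots]) (use pos in auto)
  finally have "n \<le> card (?P ` (UNIV - {0}))" using pos by simp
  hence "card {x::'b. x ^ n = 1} \<le> card (?P ` (UNIV - {0}))"
    using roots[of n 1] pos by linarith
  moreover have "?P ` (UNIV - {0}) \<subseteq> {x. x ^ n = 1}"
    using finite_field_power_card_minus_one by (auto simp: mn simp flip: power_mult)
  ultimately have "?P ` (UNIV - {0}) = {x. x ^ n = 1}"
    by (intro card_seteq) auto
  hence "y \<in> ?P ` (UNIV - {0})" using y by simp
  thus ?thesis by auto
qed

lemma (in vector_space) card_span_independent:
  assumes fin: "finite (UNIV :: 'a set)" "finite B" and indep: "independent B"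
  shows "card (span B) = CARD('a) ^ card B"
proof -
  let ?comb = "\<lambda>g. \<Sum>v\<in>B. g v *s v"
  have "span B = ?comb ` (B \<rightarrow>\<^sub>E UNIV)"
  proof (intro subset_antisym subsetI)
    fix x assume "x \<in> span B"
    then obtain g where "x = ?comb g" by (auto simp: span_finite[OF \<open>finite B\<close>])
    hence "x = ?comb (restrict g B)" by simp
    thus "x \<in> ?comb ` (B \<rightarrow>\<^sub>E UNIV)" by (intro image_eqI[of _ _ "restrict g B"]) auto
  qed (auto simp: span_finite[OF \<open>finite B\<close>])
  moreover have "inj_on ?comb (B \<rightarrow>\<^sub>E UNIV)"
  proof (rule inj_onI)
    fix g h assume gh: "g \<in> B \<rightarrow>\<^sub>E UNIV" "h \<in> B \<rightarrow>\<^sub>E UNIV" and eq: "?comb g = ?comb h"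
    have "(\<Sum>v\<in>B. (g v - h v) *s v) = 0"
      using eq by (simp add: scale_left_diff_distrib sum_subtractf)
    hence "g v - h v = 0" if "v \<in> B" for v
      by (rule independentD[OF indep \<open>finite B\<close> subset_refl _ that])
    thus "g = h" using gh by (intro PiE_ext[of g B]) auto
  qed
  ultimately show ?thesis by (simp add: card_image card_PiE fin)
qed

section \<open>The Frobenius map and linearized polynomials\<close>

locale quartic_extension =
  fixes q :: nat and \<iota> :: "'k::{field,finite} \<Rightarrow> 'a::{field,finite}"
  assumes primepow_q: "primepow q"
    and card_k: "CARD('k) = q"
    and card_a: "CARD('a) = q ^ 4"
    and embedding: "field_embedding \<iota>"
begin

definition frob :: "'a \<Rightarrow> 'a" ("\<phi>") where "\<phi> x = x ^ q"

lemma q_gt_1: "q > 1" using primepow_q primepow_gt_Suc_0 by simp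

lemma q_eq_CHAR_power:
  obtains k where "prime CHAR('a)" "q = CHAR('a) ^ k"
proof -
  obtain p k where p: "prime p" "q = p ^ k"
    using primepow_q by (auto simp: primepow_def)
  have "CHAR('a) > 0" by (rule finite_imp_CHAR_pos) simp
  hence prime: "prime CHAR('a)" by (rule prime_CHAR_semidom)
  have "CHAR('a) dvd p ^ (k * 4)"
    using CHAR_dvd_CARD[where ?'a = 'a] by (simp add: card_a p(2) power_mult)
  hence "CHAR('a) = p"
    using prime p(1) primes_dvd_imp_eq prime_dvd_power by blast
  thus thesis using that prime p(2) by simp
qed

lemma frob_add [simp]: "\<phi> (x + y) = \<phi> x + \<phi> y"
  unfolding frob_def by (rule q_eq_CHAR_power, rule freshmans_dream')

lemma frob_0 [simp]: "\<phi> 0 = 0" and frob_1 [simp]: "\<phi> 1 = 1"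
  using q_gt_1 by (auto simp: frob_def)

lemma frob_mult [simp]: "\<phi> (x * y) = \<phi> x * \<phi> y"
  by (simp add: frob_def power_mult_distrib)

lemma frob_minus [simp]: "\<phi> (- x) = - \<phi> x"
  using frob_add[of x "- x"] by (simp add: eq_neg_iff_add_eq_0 add.commute)

lemma frob_diff [simp]: "\<phi> (x - y) = \<phi> x - \<phi> y"
  using frob_add[of x "- y"] by simp

lemma frob_divide [simp]: "\<phi> (x / y) = \<phi> x / \<phi> y"
  by (simp add: frob_def power_divide)

lemma frob_eq_0_iff [simp]: "\<phi> x = 0 \<longleftrightarrow> x = 0"
  using q_gt_1 by (simp add: frob_def)

lemma frob_eq_iff [simp]: "\<phi> x = \<phi> y \<longleftrightarrow> x = y"
  using frob_eq_0_iff[of "x - y"] by simp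

lemma frob_frob: "\<phi> (\<phi> x) = x ^ q\<^sup>2"
  by (simp add: frob_def power2_eq_square flip: power_mult)

lemma frob_frob_frob: "\<phi> (\<phi> (\<phi> x)) = x ^ q ^ 3"
  by (simp add: frob_def power3_eq_cube flip: power_mult)

lemma frob_4 [simp]: "\<phi> (\<phi> (\<phi> (\<phi> x))) = x"
proof -
  have "x ^ q ^ 4 = x"
  proof (cases "x = 0")
    case False
    hence "x ^ (q ^ 4 - 1) * x = x"
      using finite_field_power_card_minus_one[of x] by (simp add: card_a)
    thus ?thesis using q_gt_1 by (simp flip: power_Suc2)
  qed (use q_gt_1 in auto)
  thus ?thesis by (simp add: frob_def power4_eq_xxxx flip: power_mult)
qed

lemma embedding_simps: "\<iota> 1 = 1" "\<iota> (x + y) = \<iota> x + \<iota> y" "\<iota> (x * y) = \<iota> x * \<iota> y"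
  using embedding by (auto simp: field_embedding_def)

lemma frob_embedding [simp]: "\<phi> (\<iota> c) = \<iota> c"
proof -
  have \<iota>_power: "\<iota> (x ^ n) = \<iota> x ^ n" for x n by (induction n) (auto simp: embedding_simps)
  have "\<iota> 0 = 0" using embedding_simps(2)[of 0 0] by (metis add_cancel_right_right add_0)
  moreover have "c ^ q = c" if "c \<noteq> 0"
  proof -
    have "c ^ (q - 1) * c = c"
      using finite_field_power_card_minus_one[OF that] by (simp add: card_k)
    thus ?thesis using q_gt_1 by (simp flip: power_Suc2)
  qed
  ultimately show ?thesis
    using q_gt_1 by (cases "c = 0") (simp_all add: frob_def flip: \<iota>_power)
qed

definition qpoly :: "'a \<Rightarrow> 'a \<Rightarrow> 'a \<Rightarrow> 'a \<Rightarrow> 'a \<Rightarrow> 'a" where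
  "qpoly a0 a1 a2 a3 x = a0 * x + a1 * \<phi> x + a2 * \<phi> (\<phi> x) + a3 * \<phi> (\<phi> (\<phi> x))"

lemma qpoly_add: "qpoly a0 a1 a2 a3 (x + y) = qpoly a0 a1 a2 a3 x + qpoly a0 a1 a2 a3 y"
  by (simp add: qpoly_def algebra_simps)

text \<open>
  A nonzero linearized polynomial is a nonzero polynomial whose degree is the \<open>q\<close>-power belonging to
  its last nonzero coefficient. As \<open>q ^ 3 < q ^ 4\<close>, it cannot vanish identically, which makes the
  coefficients of a linearized polynomial unique.
\<close>

lemma qpoly_few_roots:
  assumes "(a0, a1, a2, a3) \<noteq> (0, 0, 0, 0)"
  shows "card {x. qpoly a0 a1 a2 a3 x = 0} \<le> (if a3 \<noteq> 0 then q ^ 3 else if a2 \<noteq> 0 then q\<^sup>2 else q)"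
    (is "_ \<le> ?d")
proof -
  let ?p = "monom a0 1 + monom a1 q + monom a2 (q\<^sup>2) + monom a3 (q ^ 3)"
  have q: "1 < q" "q < q\<^sup>2" "q\<^sup>2 < q ^ 3"
    using q_gt_1 by (auto simp: power2_eq_square power3_eq_cube)
  have q3: "q < q ^ 3" "1 < q\<^sup>2" "1 < q ^ 3"
    using q by linarith+
  have "coeff ?p 1 = a0" "coeff ?p q = a1" "coeff ?p (q\<^sup>2) = a2" "coeff ?p (q ^ 3) = a3"
    using q q3 by (auto simp del: power_eq_1_iff power_strict_decreasing_iff)
  hence "?p \<noteq> 0" using assms by (metis coeff_0)
  hence "card {x. poly ?p x = 0} \<le> degree ?p" by (rule card_poly_roots_bound)
  also have "\<dots> \<le> ?d"
    by (rule degree_le) (use q q3 in auto)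
  finally show ?thesis
    by (simp only: qpoly_def frob_frob_frob) (simp only: frob_frob, simp add: poly_monom frob_def)
qed

lemma qpoly_eq_0:
  assumes "\<And>x. qpoly a0 a1 a2 a3 x = 0"
  shows "a0 = 0 \<and> a1 = 0 \<and> a2 = 0 \<and> a3 = 0"
proof (rule ccontr)
  assume "\<not> ?thesis"
  hence "q ^ 4 \<le> (if a3 \<noteq> 0 then q ^ 3 else if a2 \<noteq> 0 then q\<^sup>2 else q)"
    using qpoly_few_roots[of a0 a1 a2 a3] assms by (simp add: card_a)
  also have "\<dots> < q ^ 4"
    using q_gt_1 power_strict_increasing_iff[of q 1 4] by (auto simp: power_strict_increasing_iff)
  finally show False by simp
qed

lemma qpoly_eqD:
  assumes "\<And>x. qpoly a0 a1 a2 a3 x = qpoly b0 b1 b2 b3 x"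
  shows "a0 = b0 \<and> a1 = b1 \<and> a2 = b2 \<and> a3 = b3"
proof -
  have "qpoly (a0 - b0) (a1 - b1) (a2 - b2) (a3 - b3) x =
      qpoly a0 a1 a2 a3 x - qpoly b0 b1 b2 b3 x" for x
    by (simp add: qpoly_def algebra_simps)
  thus ?thesis using qpoly_eq_0[of "a0 - b0" "a1 - b1" "a2 - b2" "a3 - b3"] assms by simp
qed

abbreviation scale_a :: "'k \<Rightarrow> 'a \<Rightarrow> 'a" where "scale_a c x \<equiv> \<iota> c * x"

lemma vector_space_scale_a: "vector_space scale_a"
  by unfold_locales (auto simp: embedding_simps algebra_simps)

text \<open>
  A map that is linear over the small field is determined by its values on a basis, which has four
  elements, so there are at most \<open>(q ^ 4) ^ 4\<close> such maps. Linearized polynomials have four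
  coefficients and are determined by them; hence they already account for all linear maps.
\<close>

lemma linear_imp_qpoly:
  assumes add: "\<And>x y. f (x + y) = f x + f y" and scale: "\<And>c x. f (\<iota> c * x) = \<iota> c * f x"
  obtains a0 a1 a2 a3 where "f = qpoly a0 a1 a2 a3"
proof -
  interpret F: vector_space scale_a by (rule vector_space_scale_a)
  obtain B where B: "F.independent B" "UNIV \<subseteq> F.span B" using F.basis_exists[of UNIV] by blast
  have "finite B" by simp
  have "q ^ card B = q ^ 4"
    using F.card_span_independent[OF _ \<open>finite B\<close> B(1)] B(2) card_a card_k
    by (simp add: top.extremum_unique)
  hence card_B: "card B = 4" using q_gt_1 by simp
  have agree: "g x = h x"
    if eq: "\<And>b. b \<in> B \<Longrightarrow> g b = h b"
      and g: "\<And>x y. g (x + y) = g x + g y" "\<And>c x. g (\<iota> c * x) = \<iota> c * g x"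
      and h: "\<And>x y. h (x + y) = h x + h y" "\<And>c x. h (\<iota> c * x) = \<iota> c * h x"
    for g h :: "'a \<Rightarrow> 'a" and x
  proof -
    have "g 0 = 0" "h 0 = 0"
      using g(1)[of 0 0] h(1)[of 0 0] by (metis add_cancel_right_right add_0)+
    hence "F.subspace {x. g x = h x}" by (intro F.subspaceI) (auto simp: g h)
    hence "F.span B \<subseteq> {x. g x = h x}" using eq by (intro F.span_minimal) auto
    thus ?thesis using B(2) by auto
  qed
  have qpoly_scale: "qpoly a0 a1 a2 a3 (\<iota> c * x) = \<iota> c * qpoly a0 a1 a2 a3 x" for a0 a1 a2 a3 c x
    by (simp add: qpoly_def algebra_simps)
  let ?ev = "\<lambda>(a0, a1, a2, a3). restrict (qpoly a0 a1 a2 a3) B"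
  have "inj ?ev"
  proof (rule injI)
    fix s t assume ev: "?ev s = ?ev t"
    obtain a0 a1 a2 a3 b0 b1 b2 b3 where st: "s = (a0, a1, a2, a3)" "t = (b0, b1, b2, b3)"
      by (cases s, cases t)
    have eq: "restrict (qpoly a0 a1 a2 a3) B = restrict (qpoly b0 b1 b2 b3) B"
      using ev by (simp add: st)
    have "qpoly a0 a1 a2 a3 x = qpoly b0 b1 b2 b3 x" for x
    proof (rule agree[of "qpoly a0 a1 a2 a3" "qpoly b0 b1 b2 b3"])
      fix b assume "b \<in> B"
      thus "qpoly a0 a1 a2 a3 b = qpoly b0 b1 b2 b3 b" using fun_cong[OF eq, of b] by simp
    qed (rule qpoly_add qpoly_scale)+
    from qpoly_eqD[OF this] show "s = t" by (simp add: st)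
  qed
  hence "card (range ?ev) = CARD('a \<times> 'a \<times> 'a \<times> 'a)" by (rule card_image)
  also have "\<dots> = card (B \<rightarrow>\<^sub>E (UNIV :: 'a set))"
    by (simp add: card_PiE card_B power4_eq_xxxx mult_ac)
  finally have "range ?ev = B \<rightarrow>\<^sub>E UNIV"
    by (intro card_subset_eq) (auto intro: finite_PiE)
  moreover have "restrict f B \<in> B \<rightarrow>\<^sub>E UNIV" by simp
  ultimately have "restrict f B \<in> range ?ev" by (simp only:)
  then obtain a0 a1 a2 a3 where eq: "restrict f B = restrict (qpoly a0 a1 a2 a3) B" by auto
  have "f x = qpoly a0 a1 a2 a3 x" for x
  proof (rule agree[of f "qpoly a0 a1 a2 a3"])
    fix b assume "b \<in> B"
    thus "f b = qpoly a0 a1 a2 a3 b" using fun_cong[OF eq, of b] by simp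
  qed (rule add scale qpoly_add qpoly_scale)+
  thus thesis using that by blast
qed

section \<open>Traces, norms and quadratic equations\<close>

definition Tr :: "'a \<Rightarrow> 'a" where "Tr = qpoly 1 1 1 1"

text \<open>
  The additive form of Hilbert 90, together with the size of the fixed field of \<open>\<phi>\<close>. The kernel of
  \<open>\<phi> t - t\<close> has at most \<open>q\<close> elements and its range lies in the kernel of the trace, which has at most
  \<open>q ^ 3\<close> elements. The product of the two sizes is \<open>q ^ 4\<close>, so both bounds are attained.
\<close>

lemma additive_hilbert_90:
  shows card_frob_fixed: "card {x. \<phi> x = x} = q"
    and trace_zero_imp_difference: "Tr w = 0 \<Longrightarrow> \<exists>t. \<phi> t - t = w"
proof -
  let ?h = "\<lambda>t. \<phi> t - t"
  have sub: "range ?h \<subseteq> {w. Tr w = 0}"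
    by (auto simp: Tr_def qpoly_def)
  have tr: "card {w. Tr w = 0} \<le> q ^ 3"
    using qpoly_few_roots[of 1 1 1 1] by (simp add: Tr_def)
  have ker: "card {x. \<phi> x = x} \<le> q"
    using qpoly_few_roots[of "-1" 1 0 0] by (simp add: qpoly_def)
  have prod: "card (range ?h) * card {x. \<phi> x = x} = q ^ 4"
    using card_range_times_card_kernel[of ?h] by (simp add: card_a algebra_simps)
  have 4: "q ^ 4 = q ^ 3 * q" by (simp add: power_numeral_reduce)
  have le: "card (range ?h) \<le> q ^ 3"
    using card_mono[OF _ sub] tr by simp
  show "card {x. \<phi> x = x} = q"
  proof (rule ccontr)
    assume "\<not> ?thesis"
    hence "card {x. \<phi> x = x} < q" using ker by simp
    hence "card (range ?h) * card {x. \<phi> x = x} < q ^ 3 * q"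
      using le q_gt_1 card_gt_0_iff[of "range ?h"] by (intro mult_le_less_imp_less) auto
    thus False using prod 4 by simp
  qed
  hence "card (range ?h) = q ^ 3" using prod 4 q_gt_1 by simp
  hence "range ?h = {w. Tr w = 0}"
    using sub tr by (intro card_seteq) auto
  thus "Tr w = 0 \<Longrightarrow> \<exists>t. \<phi> t - t = w" by (metis (mono_tags, lifting) imageE mem_Collect_eq)
qed

text \<open>
  The three factorizations of the order of the unit group belong to the norm down to the small field,
  to the norm down to the intermediate field with \<open>q\<^sup>2\<close> elements, and to the composite of the latter
  with the norm from the intermediate to the small field.
\<close>

lemma card_minus_one:
  "(q - 1) * (1 + q + q\<^sup>2 + q ^ 3) = CARD('a) - 1"
  "(q\<^sup>2 + 1) * (q\<^sup>2 - 1) = CARD('a) - 1"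
  "((q\<^sup>2 + 1) * (q + 1)) * (q - 1) = CARD('a) - 1"
proof -
  obtain n where "q = n + 1" using q_gt_1 by (metis add.commute less_imp_add_positive)
  thus "(q - 1) * (1 + q + q\<^sup>2 + q ^ 3) = CARD('a) - 1"
    "(q\<^sup>2 + 1) * (q\<^sup>2 - 1) = CARD('a) - 1"
    "((q\<^sup>2 + 1) * (q + 1)) * (q - 1) = CARD('a) - 1"
    by (simp_all add: card_a algebra_simps power_numeral_reduce)
qed

lemma hilbert_90:
  assumes "b * \<phi> b * \<phi> (\<phi> b) * \<phi> (\<phi> (\<phi> b)) = 1"
  shows "\<exists>c. c \<noteq> 0 \<and> \<phi> c = b * c"
proof -
  have "b * b ^ q * b ^ q\<^sup>2 * b ^ q ^ 3 = 1"
    using assms by (simp only: frob_frob_frob) (simp only: frob_frob, simp only: frob_def)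
  hence "b ^ (1 + q + q\<^sup>2 + q ^ 3) = 1" by (simp add: power_add mult.assoc)
  then obtain c where c: "c \<noteq> 0" "c ^ (q - 1) = b"
    using finite_field_ex_root[OF card_minus_one(1)] by blast
  have "\<phi> c = c ^ (q - 1) * c" using q_gt_1 by (simp add: frob_def flip: power_Suc2)
  thus ?thesis using c by auto
qed

lemma relative_norm_surj:
  assumes "\<phi> (\<phi> K) = K"
  shows "\<exists>u. u * \<phi> (\<phi> u) = K"
proof (cases "K = 0")
  case True
  hence "0 * \<phi> (\<phi> 0) = K" by simp
  thus ?thesis ..
next
  case False
  have "K ^ (q\<^sup>2 - 1) * K = K"
    using assms q_gt_1 by (simp add: frob_frob flip: power_Suc2)
  hence "K ^ (q\<^sup>2 - 1) = 1" using False by simp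
  then obtain u where "u ^ (q\<^sup>2 + 1) = K"
    using finite_field_ex_root[OF card_minus_one(2)] by blast
  thus ?thesis by (intro exI[of _ u]) (simp add: frob_frob)
qed

lemma intermediate_norm_surj:
  assumes "\<phi> K = K"
  shows "\<exists>r. \<phi> (\<phi> r) = r \<and> r * \<phi> r = K"
proof (cases "K = 0")
  case True
  hence "\<phi> (\<phi> 0) = 0 \<and> 0 * \<phi> 0 = K" by simp
  thus ?thesis ..
next
  case False
  have "K ^ (q - 1) * K = K"
    using assms q_gt_1 by (simp add: frob_def flip: power_Suc2)
  hence "K ^ (q - 1) = 1" using False by simp
  then obtain u where u: "u ^ ((q\<^sup>2 + 1) * (q + 1)) = K"
    using finite_field_ex_root[OF card_minus_one(3)] by blast
  have "u ^ (q\<^sup>2 + 1) = u * \<phi> (\<phi> u)" by (simp add: frob_frob)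
  with u have "(u * \<phi> (\<phi> u)) ^ (q + 1) = K" by (simp only: power_mult)
  hence "(u * \<phi> (\<phi> u)) * \<phi> (u * \<phi> (\<phi> u)) = K"
    by (simp only: frob_def power_add power_one_right mult.commute)
  moreover have "\<phi> (\<phi> (u * \<phi> (\<phi> u))) = u * \<phi> (\<phi> u)" by simp
  ultimately show ?thesis by blast
qed

text \<open>
  A quadratic equation over the small field is solvable in the intermediate field, that is, among the
  fixed points of \<open>\<phi> \<circ> \<phi>\<close>. In the algebraic closure it has a root \<open>R\<close>, and \<open>R ^ q\<close> is a root as
  well. So \<open>R ^ q\<close> is either \<open>R\<close> or the other root \<open>- B - R\<close>, and in both cases applying the \<open>q\<close>-th power
  twice returns \<open>R\<close>. In particular \<open>R ^ (q ^ 4) = R\<close>, which puts \<open>R\<close> into the large field.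
\<close>

lemma quadratic_root:
  assumes B: "\<phi> B = B" and C: "\<phi> C = C"
  shows "\<exists>r. \<phi> (\<phi> r) = r \<and> r\<^sup>2 + B * r + C = 0"
proof -
  let ?\<Phi> = "\<lambda>x :: 'a alg_closure. x ^ q"
  have add: "?\<Phi> (x + y) = ?\<Phi> x + ?\<Phi> y" for x y
    by (rule q_eq_CHAR_power, rule freshmans_dream') auto
  have "\<exists>R. poly [:to_ac C, to_ac B, 1:] R = 0"
    by (rule alg_closed_imp_poly_has_root) simp
  then obtain R where R: "R\<^sup>2 + to_ac B * R + to_ac C = 0"
    by (auto simp: power2_eq_square algebra_simps)
  have BC: "?\<Phi> (to_ac B) = to_ac B" "?\<Phi> (to_ac C) = to_ac C"
    using B C by (simp_all add: frob_def flip: to_ac_power)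
  have "(?\<Phi> R)\<^sup>2 + to_ac B * ?\<Phi> R + to_ac C = ?\<Phi> (R\<^sup>2 + to_ac B * R + to_ac C)"
    by (simp add: add power_mult_distrib BC flip: power_mult) (simp add: mult.commute)
  also have "\<dots> = 0" using R q_gt_1 by simp
  finally have "(?\<Phi> R)\<^sup>2 + to_ac B * ?\<Phi> R + to_ac C = 0" .
  moreover have "(S - R) * (S + R + to_ac B) = (S\<^sup>2 + to_ac B * S + to_ac C)
      - (R\<^sup>2 + to_ac B * R + to_ac C)" for S
    by (simp add: algebra_simps power2_eq_square)
  ultimately have "(?\<Phi> R - R) * (?\<Phi> R + R + to_ac B) = 0" using R by simp
  hence "?\<Phi> R = R \<or> ?\<Phi> R + R + to_ac B = 0" by simp
  hence \<Phi>2: "?\<Phi> (?\<Phi> R) = R"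
  proof
    assume *: "?\<Phi> R + R + to_ac B = 0"
    have "?\<Phi> (?\<Phi> R) + ?\<Phi> R + to_ac B = ?\<Phi> (?\<Phi> R + R + to_ac B)"
      by (simp only: add BC)
    also have "\<dots> = ?\<Phi> R + R + to_ac B" unfolding * using q_gt_1 by simp
    finally show ?thesis by simp
  qed auto
  (* The large field has q ^ 4 elements, as many as x ^ (q ^ 4) = x can have solutions. *)
  have "R \<in> range to_ac"
  proof -
    let ?p = "monom 1 (q ^ 4) - monom 1 1 :: 'a alg_closure poly"
    let ?S = "{x. poly ?p x = 0}"
    have q4: "1 < q ^ 4" using q_gt_1 by (intro one_less_power) auto
    have deg: "degree ?p = q ^ 4" using q4
      by (subst diff_conv_add_uminus, subst degree_add_eq_left) (auto simp: degree_monom_eq)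
    hence "?p \<noteq> 0" using q4 by auto
    hence "finite ?S" "card ?S \<le> q ^ 4"
      using poly_roots_finite[of ?p] card_poly_roots_bound[of ?p] deg by simp_all
    moreover have "range (to_ac :: 'a \<Rightarrow> _) \<subseteq> ?S"
    proof safe
      fix x :: 'a
      have "x ^ q ^ 4 = x"
        using frob_4[of x] by (simp add: frob_def power4_eq_xxxx flip: power_mult)
      thus "poly ?p (to_ac x) = 0" by (simp add: poly_monom flip: to_ac_power)
    qed
    moreover have "card (range (to_ac :: 'a \<Rightarrow> _)) = q ^ 4"
      by (subst card_image[OF inj_to_ac]) (rule card_a)
    ultimately have "range to_ac = ?S" by (intro card_seteq) auto
    moreover have "R ^ q ^ 4 = ?\<Phi> (?\<Phi> (?\<Phi> (?\<Phi> R)))"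
      by (simp add: power4_eq_xxxx flip: power_mult)
    ultimately show ?thesis by (simp add: \<Phi>2 poly_monom)
  qed
  then obtain r where r: "R = to_ac r" by blast
  have "to_ac (r\<^sup>2 + B * r + C) = 0" using R by (simp add: r)
  moreover have "to_ac (\<phi> (\<phi> r)) = to_ac r" using \<Phi>2 by (simp add: r frob_def)
  ultimately show ?thesis by (simp only: to_ac_eq_0_iff to_ac_eq_iff) blast
qed

section \<open>Eliminating the middle coefficient\<close>

text \<open>
  For \<open>f x = a \<phi> x + \<phi>\<^sup>2 x + \<phi> b \<phi>\<^sup>3 x\<close> and \<open>m = \<phi> k\<close>, this equation says, whenever \<open>f - k\<close> is
  invertible, that its inverse has no term in \<open>\<phi>\<^sup>2 x\<close>. After the translation \<open>u = m + a * \<phi> a\<close> it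
  reads \<open>u * (u' + \<delta>) = K\<close>, with \<open>u'\<close> the conjugate of \<open>u\<close> over the intermediate field.

  If \<open>\<delta> = 0\<close>, then \<open>K\<close> lies in the intermediate field and the equation asks for an element of
  given relative norm. If \<open>\<delta> \<noteq> 0\<close>, subtracting the conjugate equation shows that
  \<open>r = u * \<delta> - K\<close> lies in the intermediate field, and the equation turns into
  \<open>r\<^sup>2 + B * r + C = 0\<close> with \<open>B = K + K' + \<delta> * \<delta>'\<close> and \<open>C = K * K'\<close>. A priori \<open>B\<close> and \<open>C\<close> lie only in the
  intermediate field. What makes the equation solvable is that they are fixed by \<open>\<phi>\<close>: \<open>C\<close> is the norm
  of \<open>1 - a * b\<close>, and \<open>B\<close> is the norm of \<open>a\<close> plus the norm of \<open>b\<close> plus \<open>2\<close> minus the trace of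
  \<open>a * b\<close>.
\<close>

lemma sesquilinear_solvable:
  "\<exists>m. (m + a * \<phi> a) * (\<phi> (\<phi> m) + b * \<phi> b) = (1 - a * b) * \<phi> (1 - a * b)"
proof -
  define \<delta> where "\<delta> = b * \<phi> b - \<phi> (\<phi> (a * \<phi> a))"
  define K where "K = (1 - a * b) * \<phi> (1 - a * b)"
  have "\<exists>u. u * (\<phi> (\<phi> u) + \<delta>) = K"
  proof (cases "\<delta> = 0")
    case True
    have "\<phi> (\<phi> K) = K"
    proof -
      have 1: "b * \<phi> b = \<phi> (\<phi> a) * \<phi> (\<phi> (\<phi> a))" using True by (simp add: \<delta>_def)
      hence "\<phi> (b * \<phi> b) = \<phi> (\<phi> (\<phi> a) * \<phi> (\<phi> (\<phi> a)))" by (rule arg_cong)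
      hence 2: "\<phi> b * \<phi> (\<phi> b) = \<phi> (\<phi> (\<phi> a)) * a" by simp
      show "\<phi> (\<phi> K) = K"
      proof (cases "b = 0")
        case False
        have "\<phi> (\<phi> (\<phi> a)) * (\<phi> (\<phi> (a * b)) - a * b)
            = (\<phi> (\<phi> a) * \<phi> (\<phi> (\<phi> a))) * \<phi> (\<phi> b) - b * (\<phi> (\<phi> (\<phi> a)) * a)"
          by (simp add: algebra_simps)
        also have "\<dots> = 0" unfolding 1[symmetric] 2[symmetric] by (simp add: mult_ac)
        finally have "\<phi> (\<phi> (\<phi> a)) * (\<phi> (\<phi> (a * b)) - a * b) = 0" .
        moreover have "\<phi> (\<phi> (\<phi> a)) \<noteq> 0" using 1 False by auto
        ultimately have "\<phi> (\<phi> (a * b)) = a * b" by simp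
        hence "\<phi> (\<phi> (1 - a * b)) = 1 - a * b" by simp
        thus ?thesis by (simp only: K_def frob_mult)
      qed (simp add: K_def)
    qed
    from relative_norm_surj[OF this] show ?thesis using True by simp
  next
    case False
    define N where "N = \<delta> * \<phi> (\<phi> \<delta>)"
    define B where "B = K + \<phi> (\<phi> K) + N"
    define C where "C = K * \<phi> (\<phi> K)"
    have "\<phi> C = C" by (simp add: C_def K_def mult_ac)
    moreover have "\<phi> B = B"
    proof -
      have "B = a * \<phi> a * \<phi> (\<phi> a) * \<phi> (\<phi> (\<phi> a)) + b * \<phi> b * \<phi> (\<phi> b) * \<phi> (\<phi> (\<phi> b)) + 2 - Tr (a * b)"
        by (simp add: B_def N_def K_def \<delta>_def Tr_def qpoly_def algebra_simps)
      moreover have "\<phi> 2 = 2" using frob_add[of 1 1] by simp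
      ultimately show ?thesis by (simp add: Tr_def qpoly_def mult_ac add_ac)
    qed
    ultimately obtain r where r: "\<phi> (\<phi> r) = r" "r\<^sup>2 + B * r + C = 0"
      using quadratic_root by blast
    define u where "u = (K + r) / \<delta>"
    have "N \<noteq> 0" using False by (simp add: N_def)
    have "N * (u * (\<phi> (\<phi> u) + \<delta>) - K) = (K + r) * (\<phi> (\<phi> K) + r) + N * r"
      using False by (simp add: u_def N_def r(1) field_simps)
    also have "\<dots> = r\<^sup>2 + B * r + C" by (simp add: B_def C_def algebra_simps power2_eq_square)
    also have "\<dots> = 0" by (rule r(2))
    finally show ?thesis using \<open>N \<noteq> 0\<close> by auto
  qed
  then obtain u where "u * (\<phi> (\<phi> u) + \<delta>) = K" by blast
  hence "(u - a * \<phi> a + a * \<phi> a) * (\<phi> (\<phi> (u - a * \<phi> a)) + b * \<phi> b) = K"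
    by (simp add: \<delta>_def algebra_simps)
  thus ?thesis unfolding K_def by blast
qed

lemma nontrivial_kernel_2x2:
  fixes p r s t :: 'a
  assumes "p * t = r * s"
  obtains x y where "(x, y) \<noteq> (0, 0)" "p * x + r * y = 0" "s * x + t * y = 0"
proof (cases "p = 0 \<and> r = 0")
  case True
  show thesis
  proof (cases "s = 0 \<and> t = 0")
    case False
    thus thesis using True by (intro that[of t "- s"]) (auto simp: algebra_simps)
  qed (use True in \<open>auto intro: that[of 1 0]\<close>)
next
  case False
  thus thesis using assms by (intro that[of r "- p"]) (auto simp: algebra_simps)
qed

text \<open>
  In the composite of \<open>g\<^sub>0 x + g\<^sub>1 \<phi> x + g\<^sub>3 \<phi>\<^sup>3 x\<close> with \<open>- k x + a \<phi> x + \<phi>\<^sup>2 x + \<phi> b \<phi>\<^sup>3 x\<close>, the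
  coefficients of \<open>\<phi> x\<close>, \<open>\<phi>\<^sup>2 x\<close> and \<open>\<phi>\<^sup>3 x\<close> vanish under three linear conditions on \<open>g\<^sub>0, g\<^sub>1, g\<^sub>3\<close>.
  The first one gives \<open>g\<^sub>3\<close>, and the determinant of the remaining two vanishes exactly when
  \<open>m = \<phi> k\<close> solves the equation of \<open>sesquilinear_solvable\<close>.
\<close>

lemma left_quasi_inverse:
  obtains k g0 g1 g3 d where "(g0, g1) \<noteq> (0, 0)"
    "\<And>x. qpoly g0 g1 0 g3 (qpoly (- k) a 1 (\<phi> b) x) = d * x"
proof -
  obtain m where m: "(m + a * \<phi> a) * (\<phi> (\<phi> m) + b * \<phi> b) = (1 - a * b) * \<phi> (1 - a * b)"
    using sesquilinear_solvable by blast
  have "(1 - a * b) * (1 - m * \<phi> (\<phi> m)) = (\<phi> a + b * m) * (\<phi> b + a * \<phi> (\<phi> m))"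
    using m by (simp add: algebra_simps)
  then obtain g0 g1 where g: "(g0, g1) \<noteq> (0, 0)"
    "(1 - a * b) * g0 + (\<phi> a + b * m) * g1 = 0"
    "(\<phi> b + a * \<phi> (\<phi> m)) * g0 + (1 - m * \<phi> (\<phi> m)) * g1 = 0"
    by (rule nontrivial_kernel_2x2)
  define g3 where "g3 = g1 * m - g0 * a"
  define k where "k = \<phi> (\<phi> (\<phi> m))"
  define d where "d = - k * g0 + \<phi> (\<phi> b) * g1 + \<phi> (\<phi> (\<phi> a)) * g3"
  have "qpoly g0 g1 0 g3 (qpoly (- k) a 1 (\<phi> b) x) = d * x
    + (g0 * a - g1 * m + g3) * \<phi> x
    + (g0 + g1 * \<phi> a + g3 * b) * \<phi> (\<phi> x)
    + (g0 * \<phi> b + g1 - g3 * \<phi> (\<phi> m)) * \<phi> (\<phi> (\<phi> x))" for x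
    by (simp add: qpoly_def d_def k_def algebra_simps)
  moreover have "g0 * a - g1 * m + g3 = 0" by (simp add: g3_def)
  moreover have "g0 + g1 * \<phi> a + g3 * b = 0" using g(2) by (simp add: g3_def algebra_simps)
  moreover have "g0 * \<phi> b + g1 - g3 * \<phi> (\<phi> m) = 0" using g(3) by (simp add: g3_def algebra_simps)
  ultimately have "qpoly g0 g1 0 g3 (qpoly (- k) a 1 (\<phi> b) x) = d * x" for x by simp
  with g(1) show thesis by (rule that)
qed

text \<open>
  If \<open>d\<close> vanished, the image of the inner map \<open>A\<close> would lie in the kernel of the outer map \<open>G\<close>.
  As \<open>A\<close> has a kernel of dimension at most one, \<open>G\<close> would then have rank one, with values in
  the multiples of a vector \<open>v\<close> by the small field, so that \<open>G x / v\<close> would be fixed by \<open>\<phi>\<close>. But \<open>\<phi>\<close> shifts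
  the coefficients of a linearized polynomial cyclically, and the zero coefficient of \<open>G\<close>
  would spread to all the others.
\<close>

lemma quasi_inverse_nondegenerate:
  assumes g: "(g0, g1) \<noteq> (0, 0)"
    and comp: "\<And>x. qpoly g0 g1 0 g3 (qpoly a0 a1 a2 a3 x) = d * x"
    and ker: "\<And>x l. x \<noteq> 0 \<Longrightarrow> qpoly a0 a1 a2 a3 x = 0 \<Longrightarrow> qpoly a0 a1 a2 a3 (l * x) = 0 \<Longrightarrow> \<phi> l = l"
  shows "d \<noteq> 0"
proof
  assume "d = 0"
  let ?A = "qpoly a0 a1 a2 a3" and ?G = "qpoly g0 g1 0 g3"
  have "card {x. ?A x = 0} \<le> q"
  proof (cases "\<exists>z. z \<noteq> 0 \<and> ?A z = 0")
    case True
    then obtain z where z: "z \<noteq> 0" "?A z = 0" by blast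
    have "{x. ?A x = 0} \<subseteq> (\<lambda>l. l * z) ` {l. \<phi> l = l}"
    proof
      fix x assume "x \<in> {x. ?A x = 0}"
      hence "x / z \<in> {l. \<phi> l = l}" using ker[of z "x / z"] z by simp
      thus "x \<in> (\<lambda>l. l * z) ` {l. \<phi> l = l}" using z by (intro image_eqI[of _ _ "x / z"]) auto
    qed
    hence "card {x. ?A x = 0} \<le> card {l. \<phi> l = l}" by (intro surj_card_le) auto
    thus ?thesis by (simp add: card_frob_fixed)
  next
    case False
    have "?A 0 = 0" by (simp add: qpoly_def)
    with False have "{x. ?A x = 0} = {0}" by blast
    thus ?thesis using q_gt_1 by simp
  qed
  moreover have "card (range ?A) * card {x. ?A x = 0} = q ^ 4"
    using card_range_times_card_kernel[of ?A] qpoly_add card_a by simp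
  ultimately have "q ^ 4 \<le> card (range ?A) * q" by (metis mult_le_mono2)
  moreover have "range ?A \<subseteq> {x. ?G x = 0}" using comp \<open>d = 0\<close> by auto
  hence "card (range ?A) \<le> card {x. ?G x = 0}" by (intro card_mono) auto
  moreover have "card (range ?G) * card {x. ?G x = 0} = q ^ 4"
    using card_range_times_card_kernel[of ?G] qpoly_add card_a by simp
  ultimately have "card (range ?G) * card {x. ?G x = 0} \<le> q * card {x. ?G x = 0}"
    by (metis mult.commute mult_le_mono1 order_trans)
  moreover have "?G 0 = 0" by (simp add: qpoly_def)
  hence "card {x. ?G x = 0} > 0" by (auto simp: card_gt_0_iff)
  ultimately have card_G: "card (range ?G) \<le> q" by simp
  obtain y where y: "?G y \<noteq> 0" using qpoly_eq_0[of g0 g1 0 g3] g by auto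
  define v where "v = ?G y"
  have "(\<lambda>c. c * v) ` {c. \<phi> c = c} = range ?G"
  proof (rule card_seteq)
    show "(\<lambda>c. c * v) ` {c. \<phi> c = c} \<subseteq> range ?G"
    proof safe
      fix c assume "\<phi> c = c"
      hence "?G (c * y) = c * v" by (simp add: qpoly_def v_def algebra_simps)
      thus "c * v \<in> range ?G" by (metis rangeI)
    qed
    have "inj (\<lambda>c. c * v)" using y by (auto simp: inj_def v_def)
    hence "card ((\<lambda>c. c * v) ` {c. \<phi> c = c}) = card {c. \<phi> c = c}"
      by (intro card_image) (auto simp: inj_on_def)
    thus "card (range ?G) \<le> card ((\<lambda>c. c * v) ` {c. \<phi> c = c})"
      using card_G by (simp add: card_frob_fixed)
  qed simp
  hence image: "?G x \<in> (\<lambda>c. c * v) ` {c. \<phi> c = c}" for x by blast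
  have fixed: "\<phi> (?G x / v) = ?G x / v" for x
  proof -
    obtain c where "\<phi> c = c" "?G x = c * v" using image[of x] by blast
    moreover have "v \<noteq> 0" using y by (simp add: v_def)
    ultimately show ?thesis by simp
  qed
  have "qpoly (\<phi> (g3 / v)) (\<phi> (g0 / v)) (\<phi> (g1 / v)) 0 x = qpoly (g0 / v) (g1 / v) 0 (g3 / v) x" for x
    using fixed[of x] by (simp add: qpoly_def add_divide_distrib algebra_simps)
  from qpoly_eqD[OF this] show False using g y by (auto simp: v_def)
qed

section \<open>Excluding norm one\<close>

text \<open>
  \<open>Tr (e * (z * \<phi> z))\<close> is the value at \<open>z\<close> of a Hermitian form in two variables over the intermediate
  field; multiplying \<open>z\<close> by an element \<open>r\<close> of that field multiplies the value by \<open>r * \<phi> r\<close>. Such a form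
  is isotropic: unless \<open>1\<close> is an isotropic vector, there is a nonzero \<open>x\<close> orthogonal to \<open>1\<close>. For \<open>r\<close> in
  the intermediate field the value at \<open>x + r\<close> is then the value at \<open>x\<close> plus \<open>r * \<phi> r * Tr e\<close>, and
  \<open>r * \<phi> r\<close> can be made equal to any element of the small field.
\<close>

lemma hermitian_isotropic:
  "\<exists>z. z \<noteq> 0 \<and> Tr (e * (z * \<phi> z)) = 0"
proof (cases "Tr e = 0")
  case True
  thus ?thesis by (intro exI[of _ 1]) simp
next
  case False
  define h where "h = e + \<phi> (\<phi> (\<phi> e))"
  have Tr_e: "Tr e = h + \<phi> (\<phi> h)" by (simp add: h_def Tr_def qpoly_def)
  have h: "h \<noteq> 0" using False Tr_e by auto
  obtain t where t: "\<phi> (\<phi> t) \<noteq> t"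
  proof (rule ccontr)
    assume "\<not> thesis"
    hence "\<phi> (\<phi> x) = x" for x using that by blast
    hence "qpoly 1 0 (-1) 0 x = 0" for x by (simp add: qpoly_def)
    thus False using qpoly_eq_0[of 1 0 "-1" 0] by simp
  qed
  (* Conjugation over the intermediate field negates t - \<phi> (\<phi> t), hence x is orthogonal to 1. *)
  define x where "x = (t - \<phi> (\<phi> t)) / h"
  have "x \<noteq> 0" using t h by (simp add: x_def)
  have orth: "h * x + \<phi> (\<phi> (h * x)) = 0" using h by (simp add: x_def)
  have fix_e: "\<phi> (Tr e) = Tr e" and fix_x: "\<phi> (Tr (e * (x * \<phi> x))) = Tr (e * (x * \<phi> x))"
    by (simp_all add: Tr_def qpoly_def algebra_simps)
  obtain r where r: "\<phi> (\<phi> r) = r" "r * \<phi> r = - Tr (e * (x * \<phi> x)) / Tr e"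
    using intermediate_norm_surj[of "- Tr (e * (x * \<phi> x)) / Tr e"] by (auto simp: fix_e fix_x)
  have "Tr (e * ((x + r) * \<phi> (x + r))) = Tr (e * (x * \<phi> x)) + r * \<phi> r * Tr e
      + \<phi> r * (h * x + \<phi> (\<phi> (h * x))) + r * \<phi> (h * x + \<phi> (\<phi> (h * x)))"
    by (simp add: Tr_def qpoly_def h_def r(1) algebra_simps)
  hence "Tr (e * ((x + r) * \<phi> (x + r))) = 0"
    unfolding orth r(2) using False by simp
  moreover have "x + r \<noteq> 0"
  proof
    assume "x + r = 0"
    hence "\<phi> (\<phi> x) = x" using r(1) by (simp add: add_eq_0_iff)
    hence "x * Tr e = 0" using orth Tr_e by (simp add: algebra_simps)
    thus False using \<open>x \<noteq> 0\<close> False by simp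
  qed
  ultimately show ?thesis by blast
qed

text \<open>
  Write \<open>b = \<phi> c / c\<close> and put \<open>w = x * \<phi> x * (\<phi> l - l)\<close>. The asserted proportionality is equivalent to
  \<open>\<phi> c * w = c * \<phi> (\<phi> (\<phi> w))\<close>, which \<open>w = 1 / \<phi> c\<close> satisfies. With \<open>z = 1 / x\<close> this choice means
  \<open>\<phi> l - l = z * \<phi> z / \<phi> c\<close>; by the additive Hilbert 90 a suitable \<open>l\<close> exists as soon as the right-hand
  side has trace zero, and an isotropic vector provides such a \<open>z\<close>.
\<close>

lemma proportional_vectors_if_norm_one:
  assumes "b * \<phi> b * \<phi> (\<phi> b) * \<phi> (\<phi> (\<phi> b)) = 1"
  shows "\<exists>x l. x \<noteq> 0 \<and> \<phi> l \<noteq> l \<and>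
    b * \<phi> (l * x) + \<phi> (\<phi> (\<phi> (l * x))) = l * (b * \<phi> x + \<phi> (\<phi> (\<phi> x)))"
proof -
  obtain c where c: "c \<noteq> 0" "\<phi> c = b * c" using hilbert_90[OF assms] by blast
  obtain z where z: "z \<noteq> 0" "Tr (1 / \<phi> c * (z * \<phi> z)) = 0" using hermitian_isotropic by blast
  obtain l where l: "\<phi> l - l = 1 / \<phi> c * (z * \<phi> z)" using trace_zero_imp_difference[OF z(2)] by blast
  have "b \<noteq> 0" using c by auto
  hence "b * \<phi> (1 / z) * (\<phi> l - l) = z / c"
    using z(1) c(1) unfolding l c(2) by (simp add: field_simps)
  moreover have "\<phi> (\<phi> (\<phi> (1 / z))) * \<phi> (\<phi> (\<phi> (\<phi> l - l))) = z / c"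
    using z(1) unfolding l by simp
  moreover have "b * \<phi> (l * x) + \<phi> (\<phi> (\<phi> (l * x))) - l * (b * \<phi> x + \<phi> (\<phi> (\<phi> x)))
      = b * \<phi> x * (\<phi> l - l) - \<phi> (\<phi> (\<phi> x)) * \<phi> (\<phi> (\<phi> (\<phi> l - l)))" for x
    by (simp add: algebra_simps)
  ultimately have "b * \<phi> (l * (1 / z)) + \<phi> (\<phi> (\<phi> (l * (1 / z))))
      = l * (b * \<phi> (1 / z) + \<phi> (\<phi> (\<phi> (1 / z))))"
    by (metis eq_iff_diff_eq_0)
  moreover have "\<phi> l \<noteq> l" using l z(1) c(1) by auto
  ultimately show ?thesis using z(1) by (intro exI[of _ "1 / z"] exI[of _ l]) simp
qed

end

section \<open>Projective equivalence of sets of vectors\<close>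

text \<open>
  Equivalence of the sets of vectors themselves is stronger than equivalence of their linear sets. It is
  used because scatteredness refers to the vectors and is carried along by it.
\<close>

definition equivalent_vectors :: "('b::field ^ 2) set \<Rightarrow> ('b ^ 2) set \<Rightarrow> bool" where
  "equivalent_vectors U V \<longleftrightarrow> (\<exists>A :: 'b ^ 2 ^ 2. invertible A \<and> (\<lambda>v. A *v v) ` U = V)"

lemma equivalent_vectors_trans:
  assumes "equivalent_vectors U V" "equivalent_vectors V W"
  shows "equivalent_vectors U W"
proof -
  obtain A B :: "'a ^ 2 ^ 2" where "invertible A" "(\<lambda>v. A *v v) ` U = V"
    "invertible B" "(\<lambda>v. B *v v) ` V = W"
    using assms by (auto simp: equivalent_vectors_def)
  thus ?thesis unfolding equivalent_vectors_def
    by (intro exI[of _ "B ** A"]) (auto simp: invertible_mult image_image simp flip: matrix_vector_mul_assoc)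
qed

lemma invertible_vector_mult_eq_0:
  fixes A :: "'b::field ^ 'n ^ 'n"
  assumes "invertible A"
  shows "A *v v = 0 \<longleftrightarrow> v = 0"
  using assms matrix_left_invertible_ker[of A] by (auto simp: invertible_def)

lemma projectively_equivalent_linear_sets:
  assumes "equivalent_vectors U V"
  shows "projectively_equivalent (linear_set U) (linear_set V)"
proof -
  obtain A :: "'a ^ 2 ^ 2" where A: "invertible A" "(\<lambda>v. A *v v) ` U = V"
    using assms by (auto simp: equivalent_vectors_def)
  have span: "(\<lambda>v. A *v v) ` vec.span {u} = vec.span {A *v u}" for u
    by (auto simp: vec.span_singleton image_image vector_scalar_commute)
  have lin: "linear_set S = (\<lambda>v. vec.span {v}) ` (S - {0})" for S :: "('a ^ 2) set"
    by (auto simp: linear_set_def)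
  have "(\<lambda>P. (\<lambda>v. A *v v) ` P) ` linear_set U = (\<lambda>u. vec.span {A *v u}) ` (U - {0})"
    by (simp add: lin image_image span)
  also have "\<dots> = (\<lambda>v. vec.span {v}) ` ((\<lambda>u. A *v u) ` (U - {0}))"
    by (simp add: image_image)
  also have "(\<lambda>u. A *v u) ` (U - {0}) = V - {0}"
    using A by (auto simp: invertible_vector_mult_eq_0)
  also have "(\<lambda>v. vec.span {v}) ` (V - {0}) = linear_set V"
    by (simp add: lin)
  finally show ?thesis using A(1) by (auto simp: projectively_equivalent_def)
qed

definition graph :: "('b \<Rightarrow> 'b::field) \<Rightarrow> ('b ^ 2) set" where
  "graph f = range (\<lambda>x. vector [x, f x])"

definition mat2 :: "'b::field \<Rightarrow> 'b \<Rightarrow> 'b \<Rightarrow> 'b \<Rightarrow> 'b ^ 2 ^ 2" where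
  "mat2 s t s' t' = vector [vector [s, t], vector [s', t']]"

lemma mat2_mult: "mat2 s t s' t' *v v = vector [s * v $ 1 + t * v $ 2, s' * v $ 1 + t' * v $ 2]"
  by (simp add: vec_eq_iff mat2_def forall_2 matrix_vector_mult_def sum_2)

lemma invertible_mat2: "s * t' \<noteq> t * s' \<Longrightarrow> invertible (mat2 s t s' t')"
  by (simp add: invertible_det_nz det_2 mat2_def)

text \<open>
  The matrix with rows \<open>(s, t)\<close> and \<open>(s', t')\<close> sends \<open>(x, f x)\<close> to a vector with first coordinate
  \<open>s x + t f x\<close>. If these first coordinates exhaust the field, they can serve as new
  parameter, and the image is again a graph.
\<close>

lemma equivalent_graphs:
  assumes det: "s * t' \<noteq> t * s'" and surj: "surj (\<lambda>x. s * x + t * f x)"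
    and g: "\<And>x. g (s * x + t * f x) = s' * x + t' * f x"
  shows "equivalent_vectors (graph f) (graph g)"
proof -
  have "(\<lambda>v. mat2 s t s' t' *v v) ` graph f = range (\<lambda>x. vector [s * x + t * f x, g (s * x + t * f x)])"
    by (simp add: graph_def image_image mat2_mult g)
  also have "\<dots> = (\<lambda>y. vector [y, g y]) ` range (\<lambda>x. s * x + t * f x)"
    by (simp add: image_image)
  finally show ?thesis
    using invertible_mat2[OF det] surj unfolding equivalent_vectors_def graph_def by auto
qed

context quartic_extension
begin

text \<open>
  This is scatteredness without dimensions: two vectors of the set on a common point differ by a
  factor from the small field, which is the fixed field of \<open>\<phi>\<close>.
\<close>

definition scattered_vectors :: "('a ^ 2) set \<Rightarrow> bool" where
  "scattered_vectors U \<longleftrightarrow> (\<forall>u\<in>U. \<forall>l. u \<noteq> 0 \<longrightarrow> l *s u \<in> U \<longrightarrow> \<phi> l = l)"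

lemma scattered_vectors_equivalent:
  assumes "equivalent_vectors U V" "scattered_vectors U"
  shows "scattered_vectors V"
  unfolding scattered_vectors_def
proof (intro ballI allI impI)
  obtain A :: "'a ^ 2 ^ 2" where A: "invertible A" "(\<lambda>v. A *v v) ` U = V"
    using assms by (auto simp: equivalent_vectors_def)
  fix v l assume v: "v \<in> V" "v \<noteq> 0" "l *s v \<in> V"
  then obtain u w where uw: "u \<in> U" "w \<in> U" "v = A *v u" "l *s v = A *v w" using A(2) by blast
  hence "A *v (w - l *s u) = 0"
    by (simp add: matrix_vector_mult_diff_distrib vector_scalar_commute)
  hence "w = l *s u" using invertible_vector_mult_eq_0[OF A(1)] by simp
  moreover have "u \<noteq> 0" using v(2) uw(3) by auto
  ultimately show "\<phi> l = l" using assms(2) uw(1,2) by (auto simp: scattered_vectors_def)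
qed

lemma scattered_graphD:
  assumes "scattered_vectors (graph f)" "x \<noteq> 0" "f (l * x) = l * f x"
  shows "\<phi> l = l"
proof -
  let ?u = "vector [x, f x] :: 'a ^ 2"
  have "l *s ?u = vector [l * x, f (l * x)]"
    using assms(3) by (simp add: vec_eq_iff forall_2)
  hence "l *s ?u \<in> graph f" "?u \<in> graph f" by (auto simp: graph_def)
  moreover have "?u \<noteq> 0" using assms(2) by (auto simp: vec_eq_iff forall_2)
  ultimately show ?thesis using assms(1) by (simp add: scattered_vectors_def)
qed

lemma vector_space_restr: "vector_space (restr_scale \<iota>)"
  by (rule vector_space_restr_scale[OF embedding])

lemma scattered_vectorsI:
  assumes "Fq_subspace \<iota> U" "scattered \<iota> U"
  shows "scattered_vectors U"
  unfolding scattered_vectors_def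
proof (intro ballI allI impI)
  interpret V: vector_space "restr_scale \<iota>" by (rule vector_space_restr)
  fix u l assume u: "u \<in> U" "u \<noteq> 0" "l *s u \<in> U"
  let ?W = "U \<inter> vec.span {u}"
  have "vec.span {u} \<in> linear_set U" using u by (auto simp: linear_set_def)
  hence "V.dim ?W = 1" using assms(2) by (simp add: scattered_def)
  then obtain B where "card B = 1" "?W \<subseteq> V.span B" using V.basis_exists[of ?W] by metis
  then obtain w where w: "?W \<subseteq> V.span {w}" by (metis card_1_singletonE)
  have "u \<in> ?W" "l *s u \<in> ?W" using u by (auto simp: vec.span_base vec.span_scale)
  with w obtain c d where cd: "u = \<iota> c *s w" "l *s u = \<iota> d *s w"
    unfolding V.span_singleton restr_scale_def by blast
  have "w \<noteq> 0" "\<iota> c \<noteq> 0" using cd(1) u(2) by auto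
  have "(l * \<iota> c - \<iota> d) *s w = 0" using cd by (simp add: vector_sub_rdistrib)
  hence "l * \<iota> c = \<iota> d" using \<open>w \<noteq> 0\<close> by simp
  hence "l = \<iota> d / \<iota> c" using \<open>\<iota> c \<noteq> 0\<close> by (simp add: field_simps)
  thus "\<phi> l = l" by simp
qed

section \<open>From scattered subspaces to the standard form\<close>

text \<open>
  The set has too few vectors to meet all \<open>q ^ 4 + 1\<close> points, and the matrix moves a missed point to the
  one with first coordinate zero. If that point itself is met, say by \<open>w\<close>, the slopes of the remaining
  vectors cannot exhaust the field.
\<close>

lemma missing_point:
  fixes U :: "('a ^ 2) set"
  assumes "card U \<le> q ^ 4"
  obtains A :: "'a ^ 2 ^ 2" where "invertible A" "\<And>u. u \<in> U \<Longrightarrow> u \<noteq> 0 \<Longrightarrow> (A *v u) $ 1 \<noteq> 0"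
proof (cases "\<exists>u\<in>U. u \<noteq> 0 \<and> u $ 1 = 0")
  case False
  thus thesis using that[of "mat2 1 0 0 1"] by (auto simp: invertible_mat2 mat2_mult)
next
  case True
  then obtain w :: "'a ^ 2" where w: "w \<in> U" "w \<noteq> 0" "w $ 1 = 0" by blast
  let ?slope = "\<lambda>u :: 'a ^ 2. u $ 2 / u $ 1"
  have "card (?slope ` (U - {w})) \<le> card (U - {w})" by (rule card_image_le) simp
  also have "\<dots> < card U" using w(1) by (intro psubset_card_mono) auto
  also have "\<dots> \<le> CARD('a)" using assms(1) card_a by simp
  finally have "?slope ` (U - {w}) \<noteq> UNIV" by auto
  then obtain m where m: "m \<notin> ?slope ` (U - {w})" by blast
  show thesis
  proof (rule that[of "mat2 (- m) 1 1 0"])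
    show "invertible (mat2 (- m) 1 1 0)" by (rule invertible_mat2) simp
    fix u assume u: "u \<in> U" "u \<noteq> 0"
    show "(mat2 (- m) 1 1 0 *v u) $ 1 \<noteq> 0"
    proof (cases "u $ 1 = 0")
      case True
      thus ?thesis using u(2) by (auto simp: mat2_mult vec_eq_iff forall_2)
    next
      case False
      hence "u \<noteq> w" using w(3) by auto
      hence "m \<noteq> u $ 2 / u $ 1" using m u by auto
      thus ?thesis using False by (auto simp: mat2_mult field_simps)
    qed
  qed
qed

text \<open>
  Once no nonzero vector of the subspace has first coordinate zero, the first coordinate is injective on
  it, and bijective because the subspace has \<open>q ^ 4\<close> elements. So the subspace is the graph of a map that
  is linear over the small field, that is, of a linearized polynomial.
\<close>

lemma equivalent_to_graph:
  assumes sub: "Fq_subspace \<iota> U" and dim: "Fq_dim \<iota> U = 4"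
  obtains a0 a1 a2 a3 where "equivalent_vectors U (graph (qpoly a0 a1 a2 a3))"
proof -
  interpret V: vector_space "restr_scale \<iota>" by (rule vector_space_restr)
  obtain B where B: "B \<subseteq> U" "V.independent B" "U \<subseteq> V.span B" "card B = 4"
    using V.basis_exists[of U] dim by metis
  have "V.span B = U" using B sub V.span_minimal by blast
  hence card_U: "card U = q ^ 4"
    using V.card_span_independent[OF _ _ B(2)] B(4) card_k by simp
  obtain A :: "'a ^ 2 ^ 2" where A: "invertible A" "\<And>u. u \<in> U \<Longrightarrow> u \<noteq> 0 \<Longrightarrow> (A *v u) $ 1 \<noteq> 0"
    using missing_point[of U] card_U by auto
  let ?p = "\<lambda>u. (A *v u) $ 1"
  have "inj_on ?p U"
  proof (rule inj_onI)
    fix u v assume uv: "u \<in> U" "v \<in> U" "?p u = ?p v"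
    hence "u - v \<in> U" "?p (u - v) = 0"
      using V.subspace_diff[OF sub] by (auto simp: matrix_vector_mult_diff_distrib)
    thus "u = v" using A(2)[of "u - v"] by auto
  qed
  hence "card (?p ` U) = CARD('a)" by (simp add: card_image card_U card_a)
  hence surj: "?p ` U = UNIV" by (intro card_subset_eq) auto
  define s where "s = inv_into U ?p"
  have s: "s x \<in> U" "?p (s x) = x" for x
    using inv_into_into[of x ?p U] f_inv_into_f[of x ?p U] surj by (auto simp: s_def)
  have s_eq: "s (?p u) = u" if "u \<in> U" for u
    unfolding s_def by (rule inv_into_f_f[OF \<open>inj_on ?p U\<close> that])
  define f where "f = (\<lambda>x. (A *v s x) $ 2)"
  have s_add: "s (x + y) = s x + s y" for x y
    using s_eq[of "s x + s y"] V.subspace_add[OF sub s(1)[of x] s(1)[of y]]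
    by (simp add: matrix_vector_right_distrib s(2))
  have s_scale: "s (\<iota> c * x) = \<iota> c *s s x" for c x
    using s_eq[of "\<iota> c *s s x"] V.subspace_scale[OF sub s(1)[of x], of c]
    by (simp add: restr_scale_def vector_scalar_commute s(2))
  obtain a0 a1 a2 a3 where f: "f = qpoly a0 a1 a2 a3"
  proof (rule linear_imp_qpoly)
    show "f (x + y) = f x + f y" for x y by (simp add: f_def s_add matrix_vector_right_distrib)
    show "f (\<iota> c * x) = \<iota> c * f x" for c x by (simp add: f_def s_scale vector_scalar_commute)
  qed
  have "(\<lambda>v. A *v v) ` U = graph f"
  proof -
    have "U = range s"
      using s s_eq by (metis (no_types, lifting) image_iff rangeI subsetI subset_antisym)
    moreover have "A *v s x = vector [x, f x]" for x
      by (simp add: vec_eq_iff forall_2 s(2) f_def)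
    ultimately show ?thesis by (simp add: graph_def image_image)
  qed
  thus thesis using that[of a0 a1 a2 a3] A(1) f by (auto simp: equivalent_vectors_def)
qed

definition standard_form :: "'a \<Rightarrow> 'a \<Rightarrow> 'a" where
  "standard_form b x = b * \<phi> x + \<phi> (\<phi> (\<phi> x))"

text \<open>
  The linear term is removed by a shear and the coefficient of \<open>\<phi> (\<phi> (\<phi> x))\<close> is scaled to one. If
  that coefficient vanishes, the graph of \<open>a1 * \<phi> x\<close> remains; interchanging the coordinates and
  rescaling yields the graph of \<open>\<phi> (\<phi> (\<phi> x))\<close>, the inverse of \<open>\<phi>\<close>.
\<close>

lemma standard_form_if_a2_eq_0:
  assumes "scattered_vectors (graph (qpoly a0 a1 0 a3))"
  obtains b where "equivalent_vectors (graph (qpoly a0 a1 0 a3)) (graph (standard_form b))"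
proof (cases "a3 = 0")
  case False
  have "equivalent_vectors (graph (qpoly a0 a1 0 a3)) (graph (standard_form (a1 / a3)))"
    using False
    by (intro equivalent_graphs[of 1 "1 / a3" 0 "- a0 / a3"])
      (auto simp: standard_form_def qpoly_def field_simps)
  thus thesis by (rule that)
next
  case True
  have "a1 \<noteq> 0"
  proof
    assume "a1 = 0"
    hence "\<phi> l = l" for l
      using scattered_graphD[OF assms, of 1 l] True by (simp add: qpoly_def)
    hence "qpoly (-1) 1 0 0 l = 0" for l by (simp add: qpoly_def)
    thus False using qpoly_eq_0[of "-1" 1 0 0] by simp
  qed
  have "equivalent_vectors (graph (qpoly a0 a1 0 a3)) (graph (standard_form 0))"
  proof (rule equivalent_graphs[of "- a0" 0 1 "\<phi> (\<phi> (\<phi> a1))"])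
    have "\<exists>x. y = a1 * \<phi> x" for y
      using \<open>a1 \<noteq> 0\<close> by (intro exI[of _ "\<phi> (\<phi> (\<phi> (y / a1)))"]) simp
    thus "surj (\<lambda>x. - a0 * x + 1 * qpoly a0 a1 0 a3 x)" by (simp add: qpoly_def True surj_def)
  qed (use \<open>a1 \<noteq> 0\<close> True in \<open>auto simp: standard_form_def qpoly_def\<close>)
  thus thesis by (rule that)
qed

text \<open>
  Let \<open>f\<close> be normalized to have no linear term and middle coefficient one. Taking \<open>f x - k x\<close> as the
  new first coordinate and \<open>x\<close> as the second turns the graph of \<open>f\<close> into the graph of the inverse of
  \<open>f - k\<close>, and \<open>k\<close> can be chosen such that this inverse has no term in \<open>\<phi> (\<phi> x)\<close>. Scatteredness
  enters through the kernel of \<open>f - k\<close>, which it restricts to dimension at most one.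
\<close>

lemma eliminate_a2:
  assumes scat: "scattered_vectors (graph (qpoly a0 a1 a2 a3))" and a2: "a2 \<noteq> 0"
  obtains g0 g1 g3 where "equivalent_vectors (graph (qpoly a0 a1 a2 a3)) (graph (qpoly g0 g1 0 g3))"
proof -
  define a b where "a = a1 / a2" and "b = \<phi> (\<phi> (\<phi> (a3 / a2)))"
  let ?f = "qpoly 0 a 1 (\<phi> b)"
  have equiv: "equivalent_vectors (graph (qpoly a0 a1 a2 a3)) (graph ?f)"
    using a2 by (intro equivalent_graphs[of 1 "1 / a2" 0 "- a0 / a2"])
      (auto simp: qpoly_def a_def b_def field_simps)
  note scat' = scattered_vectors_equivalent[OF this scat]
  obtain k g0 g1 g3 d where g: "(g0, g1) \<noteq> (0, 0)"
    "\<And>x. qpoly g0 g1 0 g3 (qpoly (- k) a 1 (\<phi> b) x) = d * x"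
    by (rule left_quasi_inverse[of a b]) blast
  let ?A = "qpoly (- k) a 1 (\<phi> b)"
  have A: "?A x = - k * x + ?f x" for x by (simp add: qpoly_def)
  have "d \<noteq> 0"
  proof (rule quasi_inverse_nondegenerate[OF g])
    fix x l assume "x \<noteq> 0" "?A x = 0" "?A (l * x) = 0"
    hence "?f x = k * x" "?f (l * x) = k * (l * x)" by (simp_all add: A)
    hence "?f (l * x) = l * ?f x" by simp
    thus "\<phi> l = l" by (rule scattered_graphD[OF scat' \<open>x \<noteq> 0\<close>])
  qed
  have "inj ?A"
  proof (rule injI)
    fix x y assume "?A x = ?A y"
    hence "d * x = d * y" using g(2) by metis
    thus "x = y" using \<open>d \<noteq> 0\<close> by simp
  qed
  hence "surj ?A" by (simp add: finite_UNIV_inj_surj)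
  have "equivalent_vectors (graph ?f) (graph (qpoly (g0 / d) (g1 / d) 0 (g3 / d)))"
  proof (rule equivalent_graphs[of "- k" 0 1 1])
    show "surj (\<lambda>x. - k * x + 1 * ?f x)" using \<open>surj ?A\<close> by (simp add: A)
    fix x
    have "qpoly (g0 / d) (g1 / d) 0 (g3 / d) (?A x) = qpoly g0 g1 0 g3 (?A x) / d"
      by (simp add: qpoly_def[of _ _ 0] add_divide_distrib)
    thus "qpoly (g0 / d) (g1 / d) 0 (g3 / d) (- k * x + 1 * ?f x) = 1 * x + 0 * ?f x"
      using \<open>d \<noteq> 0\<close> g(2)[of x] by (simp add: A)
  qed simp
  thus thesis using equivalent_vectors_trans[OF equiv] that by blast
qed

lemma exists_standard_form:
  assumes "scattered_vectors (graph (qpoly a0 a1 a2 a3))"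
  obtains b where "equivalent_vectors (graph (qpoly a0 a1 a2 a3)) (graph (standard_form b))"
proof (cases "a2 = 0")
  case True
  thus thesis using standard_form_if_a2_eq_0 assms that by metis
next
  case False
  then obtain g0 g1 g3 where g: "equivalent_vectors (graph (qpoly a0 a1 a2 a3)) (graph (qpoly g0 g1 0 g3))"
    by (rule eliminate_a2[OF assms])
  with assms have "scattered_vectors (graph (qpoly g0 g1 0 g3))"
    by (rule scattered_vectors_equivalent[rotated])
  then obtain b where "equivalent_vectors (graph (qpoly g0 g1 0 g3)) (graph (standard_form b))"
    by (rule standard_form_if_a2_eq_0)
  thus thesis using that equivalent_vectors_trans[OF g] by blast
qed

lemma norm_standard_form:
  assumes "scattered_vectors (graph (standard_form b))"
  shows "field_norm4 q b \<noteq> 1"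
proof
  assume "field_norm4 q b = 1"
  hence "b * \<phi> b * \<phi> (\<phi> b) * \<phi> (\<phi> (\<phi> b)) = 1"
    unfolding frob_frob_frob unfolding frob_frob unfolding frob_def
    by (simp add: field_norm4_def power_add mult.assoc)
  then obtain x l where xl: "x \<noteq> 0" "\<phi> l \<noteq> l" "standard_form b (l * x) = l * standard_form b x"
    unfolding standard_form_def using proportional_vectors_if_norm_one by blast
  thus False using scattered_graphD[OF assms] by blast
qed

lemma graph_standard_form: "graph (standard_form b) = U_sub q b"
  by (auto simp: graph_def U_sub_def standard_form_def frob_frob_frob) (auto simp: frob_def)

lemma maximum_scattered_classification:
  assumes "maximum_scattered_linear_set \<iota> L"
  shows "\<exists>b. field_norm4 q b \<noteq> 1 \<and> projectively_equivalent L (linear_set (U_sub q b))"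
proof -
  obtain U where U: "Fq_subspace \<iota> U" "L = linear_set U" "scattered \<iota> U" "Fq_dim \<iota> U = 4"
    using assms by (auto simp: maximum_scattered_linear_set_def)
  obtain a0 a1 a2 a3 where a: "equivalent_vectors U (graph (qpoly a0 a1 a2 a3))"
    using equivalent_to_graph[OF U(1,4)] by blast
  moreover from this have "scattered_vectors (graph (qpoly a0 a1 a2 a3))"
    using scattered_vectors_equivalent scattered_vectorsI[OF U(1,3)] by blast
  then obtain b where "equivalent_vectors (graph (qpoly a0 a1 a2 a3)) (graph (standard_form b))"
    by (rule exists_standard_form)
  ultimately have b: "equivalent_vectors U (graph (standard_form b))"
    by (rule equivalent_vectors_trans)
  hence "field_norm4 q b \<noteq> 1"
    using norm_standard_form scattered_vectors_equivalent scattered_vectorsI[OF U(1,3)] by blast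
  moreover have "projectively_equivalent L (linear_set (U_sub q b))"
    using projectively_equivalent_linear_sets[OF b] by (simp add: U(2) graph_standard_form)
  ultimately show ?thesis by blast
qed

end

theorem theorem3p4:
  fixes q :: nat
    and \<iota> :: "'k::{field,finite} \<Rightarrow> 'a::{field,finite}"
    and L :: "('a ^ 2) set set"
  assumes "primepow q"
    and "CARD('k) = q"
    and "CARD('a) = q ^ 4"
    and "field_embedding \<iota>"
    and "maximum_scattered_linear_set \<iota> L"
  shows "\<exists>b :: 'a. field_norm4 q b \<noteq> 1 \<and> projectively_equivalent L (linear_set (U_sub q b))"
proof -
  interpret quartic_extension q \<iota> by unfold_locales (rule assms)+
  show ?thesis by (rule maximum_scattered_classification[OF assms(5)])
qed

end
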